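(* Let $M_0$ be the weighted Laplacian of a weighted graph $\mathcal{G}=(\mathcal{V},\mathcal{E},W)$ with $n$ nodes, maximal degree $d_{\max}$, and largest and smallest edge weights $W_{\max}$ and $W_{\min}$. Let $R\ge 1$, $\epsilon\in(0,\tfrac12]$, and $\alpha=\min\left\{n,\frac{d_{\max}^{R+1}-1}{d_{\max}-1}\right\}$ (an upper bound on the size of the $R$-hop neighbourhood of every node). There exists a decentralized algorithm that uses only $R$-hop communication between nodes and computes an $\epsilon$-approximate solution of $M_0x=b_0$ in $$\mathcal{O}\left(\frac{n^3\alpha}{R}\,\frac{W_{\max}}{W_{\min}}\,\log\left(\tfrac1\epsilon\right)\right)$$ time steps.
   Context: $\mathcal{G}$ is undirected with edge weights $W_{ij}>0$; its weighted Laplacian has off-diagonal entries $[M_0]_{ij}=-W_{ij}$ and diagonal entries $[M_0]_{ii}=\sum_{j\neq i}W_{ij}$. The $R$-hop neighbourhood of $v_k$ is $\mathbb{N}_R(v_k)=\{v\in\mathcal{V}:\mathrm{dist}(v_k,v)\le R\}$. $\epsilon$-approximate solution: with $x^\star$ a solution of $M_0x=b_0$ (the system being solvable), a vector $\tilde x$ with $\|x^\star-\tilde x\|_{M_0}\le\epsilon\|x^\star\|_{M_0}$, where $\|u\|_{M_0}^2=u^{\mathsf T}M_0u$. Computational model: each node of $\mathcal{G}$ is a processor with its own memory, and all nodes work in parallel; node $v_k$ knows the $k$-th row of $M_0$, the component $[b_0]_k$, $R$ and $\epsilon$, and outputs the $k$-th component of $\tilde x$. $R$-hop communication means that node $v_k$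 only exchanges data with nodes in $\mathbb{N}_R(v_k)$. The number of time steps counts the arithmetic operations performed by a node.
   Formalization: The denominator R is replaced by min(R,n), since the bound as written tends to 0 as R grows (already false for a single edge); the graph is assumed to have at least one edge, and for d_max=1 the quotient in α is read as R+1. *)

theory Defs
  imports
    "HOL-Library.Extended_Nat"
    "Jordan_Normal_Form.Matrix"
begin

section \<open>Weighted graphs and Laplacian systems\<close>

text \<open>The vertices of a graph with \<open>n\<close> nodes are \<open>0, \<dots>, n - 1\<close>. An undirected edge is
  represented by the two pairs \<open>(i, j)\<close> and \<open>(j, i)\<close>; the values of \<open>W\<close> outside \<open>E\<close> are
  irrelevant. Connectedness is not assumed.\<close>

definition weighted_graph :: "nat \<Rightarrow> (nat \<times> nat) set \<Rightarrow> (nat \<Rightarrow> nat \<Rightarrow> real) \<Rightarrow> bool" where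
  "weighted_graph n E W \<longleftrightarrow>
     E \<subseteq> {..<n} \<times> {..<n} \<and> sym E \<and> irrefl E \<and>
     (\<forall>(i, j) \<in> E. W i j > 0 \<and> W i j = W j i)"

definition laplacian :: "nat \<Rightarrow> (nat \<times> nat) set \<Rightarrow> (nat \<Rightarrow> nat \<Rightarrow> real) \<Rightarrow> real mat" where
  "laplacian n E W = mat n n (\<lambda>(i, j).
     if i = j then (\<Sum>l | (i, l) \<in> E. W i l)
     else if (i, j) \<in> E then - W i j else 0)"

definition max_degree :: "nat \<Rightarrow> (nat \<times> nat) set \<Rightarrow> nat" where
  "max_degree n E = Max ((\<lambda>i. card {j. (i, j) \<in> E}) ` {..<n})"

definition max_weight :: "(nat \<times> nat) set \<Rightarrow> (nat \<Rightarrow> nat \<Rightarrow> real) \<Rightarrow> real" where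
  "max_weight E W = Max ((\<lambda>(i, j). W i j) ` E)"

definition min_weight :: "(nat \<times> nat) set \<Rightarrow> (nat \<Rightarrow> nat \<Rightarrow> real) \<Rightarrow> real" where
  "min_weight E W = Min ((\<lambda>(i, j). W i j) ` E)"

definition graph_dist :: "(nat \<times> nat) set \<Rightarrow> nat \<Rightarrow> nat \<Rightarrow> enat" where
  "graph_dist E u v = (INF m \<in> {m. (u, v) \<in> E ^^ m}. enat m)"

text \<open>Finite distances are less than \<open>n\<close>, so a radius \<open>R > n\<close> gives the same neighbourhoods as
  the radius \<open>n\<close>; the effective radius is \<open>min R n\<close>.\<close>

definition hop_nbhd :: "nat \<Rightarrow> (nat \<times> nat) set \<Rightarrow> nat \<Rightarrow> nat \<Rightarrow> nat set" where
  "hop_nbhd n E R k = {v \<in> {..<n}. graph_dist E k v \<le> enat R}"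

text \<open>The quotient \<open>(d ^ (R + 1) - 1) / (d - 1)\<close> stands for the geometric sum
  \<open>1 + d + \<dots> + d ^ R\<close>, which is \<open>R + 1\<close> in the case \<open>d = 1\<close>.\<close>

definition nbhd_bound :: "nat \<Rightarrow> nat \<Rightarrow> nat \<Rightarrow> real" where
  "nbhd_bound n d R =
     min (real n) (if d = 1 then real (R + 1) else (real d ^ (R + 1) - 1) / (real d - 1))"

definition energy_norm :: "real mat \<Rightarrow> real vec \<Rightarrow> real" where
  "energy_norm M u = sqrt (u \<bullet> (M *\<^sub>v u))"

text \<open>For a Laplacian, two solutions of the same system differ by an element of the kernel, so
  that the condition does not depend on the choice of the solution.\<close>

definition approx_solution :: "real mat \<Rightarrow> real vec \<Rightarrow> real \<Rightarrow> real vec \<Rightarrow> bool" where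
  "approx_solution M b \<epsilon> y \<longleftrightarrow>
     (\<forall>x \<in> carrier_vec (dim_col M).
        M *\<^sub>v x = b \<longrightarrow> energy_norm M (x - y) \<le> \<epsilon> * energy_norm M x)"


section \<open>Decentralized algorithms\<close>

text \<open>Every processor has natural-number variables, used for counting and addressing, and
  two-dimensional arrays of reals. There is no conversion between the two sorts of data, and
  real constants in a program are integers. The component \<open>steps\<close> counts the elementary
  operations that the processor has performed; programs cannot read it.\<close>

type_synonym name = string
type_synonym memory = "name \<Rightarrow> nat \<Rightarrow> nat \<Rightarrow> real"

record node =
  nvar :: "name \<Rightarrow> nat"
  cell :: memory
  steps :: nat

datatype nexp = NConst nat | NVar name | NAdd nexp nexp | NSub nexp nexp

datatype rexp =
  RConst int | RCell name nexp nexp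
  | RAdd rexp rexp | RSub rexp rexp | RMul rexp rexp | RDiv rexp rexp

datatype test = NLess nexp nexp | RLess rexp rexp | TNot test | TAnd test test

text \<open>\<open>Recv a i j s a' i' j'\<close> copies the entry \<open>a'(i', j')\<close> of processor \<open>s\<close> to the local entry
  \<open>a(i, j)\<close>. It is the only command that involves another processor, and it has no effect if
  processor \<open>s\<close> is out of range. The bound of a \<open>For\<close> loop is evaluated once, on entry.\<close>

datatype com =
  Skip
  | NAssign name nexp
  | RAssign name nexp nexp rexp
  | Recv name nexp nexp nexp name nexp nexp
  | Seq com com
  | Cond test com com
  | For name nexp com

primrec nval :: "nexp \<Rightarrow> node \<Rightarrow> nat" where
  "nval (NConst c) s = c"
| "nval (NVar x) s = nvar s x"
| "nval (NAdd e f) s = nval e s + nval f s"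
| "nval (NSub e f) s = nval e s - nval f s"

primrec rval :: "rexp \<Rightarrow> node \<Rightarrow> real" where
  "rval (RConst c) s = of_int c"
| "rval (RCell a i j) s = cell s a (nval i s) (nval j s)"
| "rval (RAdd e f) s = rval e s + rval f s"
| "rval (RSub e f) s = rval e s - rval f s"
| "rval (RMul e f) s = rval e s * rval f s"
| "rval (RDiv e f) s = rval e s / rval f s"

primrec tval :: "test \<Rightarrow> node \<Rightarrow> bool" where
  "tval (NLess e f) s \<longleftrightarrow> nval e s < nval f s"
| "tval (RLess e f) s \<longleftrightarrow> rval e s < rval f s"
| "tval (TNot t) s \<longleftrightarrow> \<not> tval t s"
| "tval (TAnd t u) s \<longleftrightarrow> tval t s \<and> tval u s"

text \<open>Not only the arithmetic operations but also memory accesses, comparisons, logical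
  connectives, transmissions and loop iterations are charged one step each. The number of
  steps is thus an upper bound for the number of arithmetic operations, and no computation is
  hidden in uncounted control flow.\<close>

primrec ncost :: "nexp \<Rightarrow> nat" where
  "ncost (NConst c) = 1"
| "ncost (NVar x) = 1"
| "ncost (NAdd e f) = 1 + ncost e + ncost f"
| "ncost (NSub e f) = 1 + ncost e + ncost f"

primrec rcost :: "rexp \<Rightarrow> nat" where
  "rcost (RConst c) = 1"
| "rcost (RCell a i j) = 1 + ncost i + ncost j"
| "rcost (RAdd e f) = 1 + rcost e + rcost f"
| "rcost (RSub e f) = 1 + rcost e + rcost f"
| "rcost (RMul e f) = 1 + rcost e + rcost f"
| "rcost (RDiv e f) = 1 + rcost e + rcost f"

primrec tcost :: "test \<Rightarrow> nat" where
  "tcost (NLess e f) = 1 + ncost e + ncost f"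
| "tcost (RLess e f) = 1 + rcost e + rcost f"
| "tcost (TNot t) = 1 + tcost t"
| "tcost (TAnd t u) = 1 + tcost t + tcost u"

definition tick :: "nat \<Rightarrow> node \<Rightarrow> node" where
  "tick c s = s\<lparr>steps := steps s + c\<rparr>"

definition set_nvar :: "name \<Rightarrow> nat \<Rightarrow> node \<Rightarrow> node" where
  "set_nvar x v s = s\<lparr>nvar := (nvar s)(x := v)\<rparr>"

definition set_cell :: "name \<Rightarrow> nat \<Rightarrow> nat \<Rightarrow> real \<Rightarrow> node \<Rightarrow> node" where
  "set_cell a i j v s = s\<lparr>cell := (cell s)(a := (cell s a)(i := (cell s a i)(j := v)))\<rparr>"

text \<open>The argument \<open>peers\<close> gives the memories of the processors within range.\<close>

primrec exec :: "com \<Rightarrow> (nat \<Rightarrow> memory option) \<Rightarrow> node \<Rightarrow> node" where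
  "exec Skip peers s = tick 1 s"
| "exec (NAssign x e) peers s = tick (1 + ncost e) (set_nvar x (nval e s) s)"
| "exec (RAssign a i j e) peers s =
     tick (1 + ncost i + ncost j + rcost e) (set_cell a (nval i s) (nval j s) (rval e s) s)"
| "exec (Recv a i j r a' i' j') peers s =
     tick (1 + ncost i + ncost j + ncost r + ncost i' + ncost j')
       (case peers (nval r s) of
          None \<Rightarrow> s
        | Some m \<Rightarrow> set_cell a (nval i s) (nval j s) (m a' (nval i' s) (nval j' s)) s)"
| "exec (Seq c d) peers s = exec d peers (exec c peers s)"
| "exec (Cond t c d) peers s =
     (if tval t s then exec c peers (tick (1 + tcost t) s)
      else exec d peers (tick (1 + tcost t) s))"
| "exec (For x e c) peers s =
     fold (\<lambda>v s. exec c peers (tick 1 (set_nvar x v s))) [0..<nval e s] (tick (1 + ncost e) s)"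

definition halted :: "node \<Rightarrow> bool" where
  "halted s \<longleftrightarrow> nvar s ''halt'' \<noteq> 0"

definition out_val :: "node \<Rightarrow> real" where
  "out_val s = cell s ''x'' 0 0"

text \<open>Initially processor \<open>k\<close> knows the number of nodes, its own index, \<open>R\<close>, \<open>\<epsilon>\<close>, row \<open>k\<close> of the
  matrix (stored as row \<open>k\<close> of an otherwise zero local array) and entry \<open>k\<close> of the right-hand
  side, and nothing else about the system or the graph.\<close>

definition init_node :: "nat \<Rightarrow> real mat \<Rightarrow> real vec \<Rightarrow> nat \<Rightarrow> real \<Rightarrow> nat \<Rightarrow> node" where
  "init_node n M b R \<epsilon> k =
     \<lparr>nvar = (\<lambda>_. 0)(''n'' := n, ''k'' := k, ''R'' := R),
      cell = (\<lambda>a i j.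
        if a = ''M'' \<and> i = k \<and> j < n then M $$ (k, j)
        else if a = ''b'' \<and> i = k \<and> j = 0 then b $ k
        else if a = ''eps'' \<and> i = 0 \<and> j = 0 then \<epsilon>
        else 0),
      steps = 0\<rparr>"

text \<open>The processors work in synchronous rounds. In each round every processor that has not
  halted executes the common program once, on its own memory; \<open>Recv\<close> refers to the memories of
  the other processors at the beginning of the round, and only to those in the \<open>R\<close>-hop
  neighbourhood. Halted processors remain readable.\<close>

definition one_round ::
    "com \<Rightarrow> nat \<Rightarrow> (nat \<times> nat) set \<Rightarrow> nat \<Rightarrow> (nat \<Rightarrow> node) \<Rightarrow> nat \<Rightarrow> node" where
  "one_round P n E R \<sigma> k =
     (if halted (\<sigma> k) then \<sigma> k
      else exec P (\<lambda>j. if j \<in> hop_nbhd n E R k then Some (cell (\<sigma> j)) else None) (\<sigma> k))"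

text \<open>\<open>run P n E R M b \<epsilon> T k\<close> is the state of processor \<open>k\<close> after \<open>T\<close> rounds.\<close>

definition run ::
    "com \<Rightarrow> nat \<Rightarrow> (nat \<times> nat) set \<Rightarrow> nat \<Rightarrow> real mat \<Rightarrow> real vec \<Rightarrow> real \<Rightarrow> nat \<Rightarrow> nat \<Rightarrow> node" where
  "run P n E R M b \<epsilon> T = (one_round P n E R ^^ T) (init_node n M b R \<epsilon>)"

text \<open>The program solves the given instance with at most \<open>t\<close> steps on each node.\<close>

definition solves_within ::
    "com \<Rightarrow> nat \<Rightarrow> (nat \<times> nat) set \<Rightarrow> nat \<Rightarrow> real mat \<Rightarrow> real vec \<Rightarrow> real \<Rightarrow> real \<Rightarrow> bool" where
  "solves_within P n E R M b \<epsilon> t \<longleftrightarrow>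
     (\<exists>T. let \<sigma> = run P n E R M b \<epsilon> T in
        (\<forall>k<n. halted (\<sigma> k)) \<and>
        approx_solution M b \<epsilon> (vec n (\<lambda>k. out_val (\<sigma> k))) \<and>
        (\<forall>k<n. real (steps (\<sigma> k)) \<le> t))"

end

theory Submission
  imports Defs "HOL-Library.Transitive_Closure_Table"
begin

text \<open>In exact arithmetic the accuracy \<open>\<epsilon>\<close> can be pushed to zero: \<open>O(n\<^sup>3)\<close> steps per node suffice
  for an exact solution, and \<open>n\<^sup>3\<close> is dominated by the time bound: the bound \<open>\<alpha>\<close> on the
  size of a neighbourhood is at least \<open>min R n\<close>, the weight ratio is at least one, and
  \<open>ln (1 / \<epsilon>) \<ge> ln 2\<close> (lemma \<open>time_bound_ge\<close>).

  The algorithm consists of \<open>n\<close> rounds of flooding and a local elimination.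

  Flooding. In each round a node looks, for every \<open>i < n\<close>, for a node in range that already has
  row \<open>i\<close> of the system, and copies that row. Rows that have not arrived are zero. A positive
  diagonal entry serves as the mark of an arrived row: the diagonal entry of a Laplacian vanishes
  only for an isolated vertex, whose entire equation reads \<open>0 = 0\<close> and carries no information.
  A search over \<open>n\<close> nodes and a copy of \<open>n\<close> entries for each of the \<open>n\<close> rows cost \<open>O(n\<^sup>2)\<close>
  per round. One hop of progress per round already carries every row through its whole component
  in \<open>n\<close> rounds, and no row ever leaves its component. After \<open>n\<close> rounds a node thus holds
  exactly the equations of its own component (lemmas \<open>gather_holds_rows\<close> and
  \<open>hops_relpow_iff\<close>).

  Elimination. The local system is in general singular, so it is solved by projections, as in
  Huang's method. A symmetric matrix \<open>H\<close>, initially the identity, is kept equal to the orthogonal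
  projection onto the complement of the rows treated so far. A row \<open>a\<close> with right-hand side
  \<open>\<beta>\<close> contributes its new direction \<open>g = H a\<close>; the iterate \<open>y\<close> moves along \<open>g\<close> until it
  satisfies the equation, and \<open>g\<close> is projected out of \<open>H\<close>. For any solution \<open>z\<close> of the system
  one has \<open>y = z - H z\<close> throughout, and in the end every row annihilates \<open>H\<close>, so that \<open>y\<close> is a
  solution (lemma \<open>sweep_solves\<close>). If \<open>a\<close> depends on earlier rows then \<open>g = 0\<close>, and the
  convention \<open>x / 0 = 0\<close> makes the step void; no pivoting or case distinction occurs. Each of
  the \<open>n\<close> rows costs \<open>O(n\<^sup>2)\<close>.

  Two nodes of one component hold the same equations and therefore compute the same vector. The
  Laplacian does not couple different components, so the entries output by the nodes fit together
  to a solution of the whole system (lemma \<open>component_solution_solves\<close>). Its energy error is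
  zero, which is at most \<open>\<epsilon>\<close> times the energy norm of a solution because the Laplacian is
  positive semidefinite (lemma \<open>exact_solution_approx\<close>).\<close>

section \<open>Reasoning about programs\<close>

lemma tick_simps [simp]:
  "nvar (tick c s) = nvar s" "cell (tick c s) = cell s" "steps (tick c s) = steps s + c"
  by (simp_all add: tick_def)

lemma tick_tick [simp]: "tick c (tick d s) = tick (c + d) s"
  by (simp add: tick_def)

lemma set_nvar_simps [simp]:
  "nvar (set_nvar x v s) = (nvar s)(x := v)" "cell (set_nvar x v s) = cell s"
  "steps (set_nvar x v s) = steps s"
  by (simp_all add: set_nvar_def)

lemma set_cell_simps [simp]:
  "nvar (set_cell a i j v s) = nvar s" "steps (set_cell a i j v s) = steps s"
  "cell (set_cell a i j v s) = (cell s)(a := (cell s a)(i := (cell s a i)(j := v)))"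
  by (simp_all add: set_cell_def)

primrec assigned :: "com \<Rightarrow> name set" where
  "assigned Skip = {}"
| "assigned (NAssign x e) = {x}"
| "assigned (RAssign a i j e) = {}"
| "assigned (Recv a i j r a' i' j') = {}"
| "assigned (Seq c d) = assigned c \<union> assigned d"
| "assigned (Cond t c d) = assigned c \<union> assigned d"
| "assigned (For x e c) = insert x (assigned c)"

primrec written :: "com \<Rightarrow> name set" where
  "written Skip = {}"
| "written (NAssign x e) = {}"
| "written (RAssign a i j e) = {a}"
| "written (Recv a i j r a' i' j') = {a}"
| "written (Seq c d) = written c \<union> written d"
| "written (Cond t c d) = written c \<union> written d"
| "written (For x e c) = written c"

lemma nvar_exec: "x \<notin> assigned c \<Longrightarrow> nvar (exec c peers s) x = nvar s x"
proof (induction c arbitrary: s)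
  case (For y e c)
  have "nvar (fold (\<lambda>v s. exec c peers (tick 1 (set_nvar y v s))) vs t) x = nvar t x" for vs t
    using For by (induction vs arbitrary: t) auto
  then show ?case by simp
qed (auto split: option.splits)

lemma cell_exec: "a \<notin> written c \<Longrightarrow> cell (exec c peers s) a = cell s a"
proof (induction c arbitrary: s)
  case (For y e c)
  have "cell (fold (\<lambda>v s. exec c peers (tick 1 (set_nvar y v s))) vs t) a = cell t a" for vs t
    using For by (induction vs arbitrary: t) auto
  then show ?case by simp
qed (auto split: option.splits)

text \<open>An invariant rule for loops. The variables and arrays outside the footprint of the body keep
  their values through all iterations; handing this to the step once and for all lets an invariant
  speak only of what the loop changes.\<close>

lemma exec_For_induct [case_names bound init step]:
  assumes bound: "nval e s = m"
    and init: "P 0 (tick (1 + ncost e) s)"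
    and step: "\<And>v t. v < m \<Longrightarrow> P v t \<Longrightarrow>
      (\<And>y. y \<notin> insert x (assigned c) \<Longrightarrow> nvar t y = nvar s y) \<Longrightarrow>
      (\<And>a. a \<notin> written c \<Longrightarrow> cell t a = cell s a) \<Longrightarrow>
      P (Suc v) (exec c peers (tick 1 (set_nvar x v t)))"
  shows "P m (exec (For x e c) peers s)"
proof -
  define loop where "loop v =
    fold (\<lambda>v s. exec c peers (tick 1 (set_nvar x v s))) [0..<v] (tick (1 + ncost e) s)" for v
  have loop_Suc: "loop (Suc v) = exec c peers (tick 1 (set_nvar x v (loop v)))" for v
    by (simp add: loop_def)
  have "P v (loop v) \<and> (\<forall>y. y \<notin> insert x (assigned c) \<longrightarrow> nvar (loop v) y = nvar s y) \<and>
      (\<forall>a. a \<notin> written c \<longrightarrow> cell (loop v) a = cell s a)" if "v \<le> m" for v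
    using that
  proof (induction v)
    case 0
    then show ?case using init by (simp add: loop_def)
  next
    case (Suc v)
    then have "P (Suc v) (loop (Suc v))"
      unfolding loop_Suc by (intro step) auto
    with Suc show ?case
      by (simp add: loop_Suc nvar_exec cell_exec)
  qed
  then show ?thesis
    using bound by (auto simp: loop_def)
qed

text \<open>If all loops run to the bound \<open>n\<close>, and \<open>n\<close> is never overwritten, the cost of a program is
  determined by its syntax up to the outcome of conditionals. Time bounds then need no reasoning
  about states.\<close>

primrec bounded_loops :: "com \<Rightarrow> bool" where
  "bounded_loops Skip = True"
| "bounded_loops (NAssign x e) \<longleftrightarrow> x \<noteq> ''n''"
| "bounded_loops (RAssign a i j e) = True"
| "bounded_loops (Recv a i j r a' i' j') = True"
| "bounded_loops (Seq c d) \<longleftrightarrow> bounded_loops c \<and> bounded_loops d"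
| "bounded_loops (Cond t c d) \<longleftrightarrow> bounded_loops c \<and> bounded_loops d"
| "bounded_loops (For x e c) \<longleftrightarrow> x \<noteq> ''n'' \<and> e = NVar ''n'' \<and> bounded_loops c"

primrec max_steps :: "nat \<Rightarrow> com \<Rightarrow> nat" where
  "max_steps n Skip = 1"
| "max_steps n (NAssign x e) = 1 + ncost e"
| "max_steps n (RAssign a i j e) = 1 + ncost i + ncost j + rcost e"
| "max_steps n (Recv a i j r a' i' j') =
     1 + ncost i + ncost j + ncost r + ncost i' + ncost j'"
| "max_steps n (Seq c d) = max_steps n c + max_steps n d"
| "max_steps n (Cond t c d) = 1 + tcost t + max (max_steps n c) (max_steps n d)"
| "max_steps n (For x e c) = 2 + n * (1 + max_steps n c)"

lemma assigned_bounded_loops: "bounded_loops c \<Longrightarrow> ''n'' \<notin> assigned c"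
  by (induction c) auto

lemma steps_exec:
  "bounded_loops c \<Longrightarrow> steps (exec c peers s) \<le> steps s + max_steps (nvar s ''n'') c"
proof (induction c arbitrary: s)
  case (Seq c d)
  then have "steps (exec d peers (exec c peers s)) \<le>
      steps (exec c peers s) + max_steps (nvar s ''n'') d"
    by (metis assigned_bounded_loops bounded_loops.simps(5) nvar_exec)
  with Seq show ?case by (fastforce intro: order_trans)
next
  case (Cond t c d)
  then show ?case
    using Cond.IH(1)[of "tick (1 + tcost t) s"] Cond.IH(2)[of "tick (1 + tcost t) s"] by auto
next
  case (For x e c)
  let ?n = "nvar s ''n''"
  have "steps (exec (For x e c) peers s) \<le> steps s + 2 + ?n * (1 + max_steps ?n c)"
  proof (induction rule: exec_For_induct
      [where P = "\<lambda>v t. steps t \<le> steps s + 2 + v * (1 + max_steps ?n c)"])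
    case (step v t)
    let ?t = "tick 1 (set_nvar x v t)"
    have "nvar ?t ''n'' = ?n"
      using For step(3)[of "''n''"] by (auto dest: assigned_bounded_loops)
    then have "steps (exec c peers ?t) \<le> steps ?t + max_steps ?n c"
      using For.IH[of ?t] For.prems by simp
    then show ?case using step(2) by simp
  qed (use For in simp_all)
  then show ?case by simp
qed (auto split: option.splits)

section \<open>Solving a linear system by projections\<close>

context
  fixes n :: nat and A :: "nat \<Rightarrow> nat \<Rightarrow> real" and b :: "nat \<Rightarrow> real"
begin

text \<open>The pair after \<open>p\<close> steps consists of the projection and of the iterate obtained from the
  first \<open>p\<close> rows of the system \<open>A x = b\<close>.\<close>

primrec sweep :: "nat \<Rightarrow> (nat \<Rightarrow> nat \<Rightarrow> real) \<times> (nat \<Rightarrow> real)" where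
  "sweep 0 = ((\<lambda>i j. if i = j then 1 else 0), (\<lambda>i. 0))"
| "sweep (Suc p) =
    (let (H, y) = sweep p;
         g = (\<lambda>i. \<Sum>j<n. H i j * A p j);
         d = (\<Sum>i<n. A p i * g i);
         e = b p - (\<Sum>i<n. A p i * y i)
     in ((\<lambda>i j. H i j - g i * g j / d), (\<lambda>i. y i + g i * e / d)))"

text \<open>Symmetry and idempotence of \<open>H\<close> give \<open>a \<bullet> H a = |H a|\<^sup>2\<close>. Hence the denominator vanishes
  only together with the direction \<open>g = H a\<close>, which is what makes division by zero harmless. The
  relation between \<open>y\<close> and an arbitrary solution \<open>z\<close> is preserved because the residual
  \<open>b\<^sub>p - a \<bullet> y\<close> of the current row equals \<open>g \<bullet> z\<close>.\<close>

lemma sweep_invariant: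
  assumes sol: "\<And>p. p < m \<Longrightarrow> (\<Sum>j<n. A p j * z j) = b p"
    and "sweep m = (H, y)"
  shows "(\<forall>i<n. \<forall>j<n. H i j = H j i) \<and>
    (\<forall>i<n. \<forall>j<n. (\<Sum>k<n. H i k * H k j) = H i j) \<and>
    (\<forall>i<n. y i = z i - (\<Sum>j<n. H i j * z j)) \<and>
    (\<forall>p<m. \<forall>j<n. (\<Sum>i<n. A p i * H i j) = 0)"
  using assms
proof (induction m arbitrary: H y)
  case 0
  have delta: "(\<Sum>j<n. (if i = j then 1 else 0) * f j) = f i" if "i < n" for i and f :: "nat \<Rightarrow> real"
    using that by (simp add: if_distrib[of "\<lambda>c. c * _"] cong: if_cong)
  from 0 show ?case by (auto simp: delta)
next
  case (Suc p)
  obtain H0 y0 where 0: "sweep p = (H0, y0)" by fastforce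
  define a where "a = A p"
  define g where "g i = (\<Sum>j<n. H0 i j * a j)" for i
  define d where "d = (\<Sum>i<n. a i * g i)"
  define e where "e = b p - (\<Sum>i<n. a i * y0 i)"
  have H: "H i j = H0 i j - g i * g j / d" and y: "y i = y0 i + g i * e / d" for i j
    using Suc.prems(2) unfolding g_def d_def e_def a_def by (auto simp: 0 Let_def)
  have IH: "(\<forall>i<n. \<forall>j<n. H0 i j = H0 j i)" "(\<forall>i<n. \<forall>j<n. (\<Sum>k<n. H0 i k * H0 k j) = H0 i j)"
    "(\<forall>i<n. y0 i = z i - (\<Sum>j<n. H0 i j * z j))"
    "(\<forall>q<p. \<forall>j<n. (\<Sum>i<n. A q i * H0 i j) = 0)"
    using Suc.IH[OF _ 0] Suc.prems(1) by auto
  have g': "g i = (\<Sum>j<n. a j * H0 j i)" if "i < n" for i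
    unfolding g_def using IH(1) that by (intro sum.cong) auto
  have Hg: "(\<Sum>k<n. H0 i k * g k) = g i" if "i < n" for i
  proof -
    have "(\<Sum>k<n. H0 i k * g k) = (\<Sum>j<n. (\<Sum>k<n. H0 i k * H0 k j) * a j)"
      unfolding g_def sum_distrib_left sum_distrib_right
      by (subst sum.swap) (simp add: mult_ac)
    then show ?thesis using IH(2) that by (simp add: g_def)
  qed
  have dg: "d = (\<Sum>k<n. g k * g k)"
  proof -
    have "d = (\<Sum>i<n. a i * (\<Sum>k<n. H0 i k * g k))"
      by (simp add: d_def Hg)
    also have "\<dots> = (\<Sum>k<n. (\<Sum>i<n. a i * H0 i k) * g k)"
      unfolding sum_distrib_left sum_distrib_right by (subst sum.swap) (simp add: mult_ac)
    finally show ?thesis by (simp add: g')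
  qed
  have g0: "g i = 0" if "d = 0" "i < n" for i
    using that dg by (simp add: sum_nonneg_eq_0_iff)
  have sym: "\<forall>i<n. \<forall>j<n. H i j = H j i"
    using IH(1) by (simp add: H mult_ac)
  have idem: "(\<Sum>k<n. H i k * H k j) = H i j" if "i < n" "j < n" for i j
  proof -
    have Hg2: "(\<Sum>k<n. g k * H0 k j) = g j"
    proof -
      have "(\<Sum>k<n. g k * H0 k j) = (\<Sum>k<n. H0 j k * g k)"
        using IH(1) that by (intro sum.cong) auto
      then show ?thesis using Hg that by simp
    qed
    have "(\<Sum>k<n. H i k * H k j) = (\<Sum>k<n. H0 i k * H0 k j) - (\<Sum>k<n. H0 i k * g k) * g j / d
        - g i * (\<Sum>k<n. g k * H0 k j) / d + g i * g j * (\<Sum>k<n. g k * g k) / (d * d)"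
      by (simp add: H sum_distrib_left sum_distrib_right sum_divide_distrib algebra_simps
          sum.distrib sum_subtractf flip: sum_subtractf sum.distrib)
    also have "\<dots> = H0 i j - g i * g j / d - g i * g j / d + g i * g j * d / (d * d)"
      using IH(2) Hg Hg2 that dg by simp
    also have "\<dots> = H i j"
      by (cases "d = 0") (simp_all add: H)
    finally show ?thesis .
  qed
  have res: "y i = z i - (\<Sum>j<n. H i j * z j)" if "i < n" for i
  proof -
    have "(\<Sum>k<n. a k * y0 k) = (\<Sum>k<n. a k * (z k - (\<Sum>j<n. H0 k j * z j)))"
      using IH(3) by simp
    also have "\<dots> = (\<Sum>k<n. a k * z k) - (\<Sum>k<n. a k * (\<Sum>j<n. H0 k j * z j))"
      by (simp add: right_diff_distrib sum_subtractf)
    also have "(\<Sum>k<n. a k * (\<Sum>j<n. H0 k j * z j)) = (\<Sum>j<n. (\<Sum>k<n. a k * H0 k j) * z j)"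
      unfolding sum_distrib_left sum_distrib_right by (subst sum.swap) (simp add: mult_ac)
    finally have "e = (\<Sum>j<n. g j * z j)"
      using Suc.prems(1)[of p] by (simp add: e_def a_def[symmetric] g')
    moreover have "(\<Sum>j<n. H i j * z j) = (\<Sum>j<n. H0 i j * z j) - g i / d * (\<Sum>j<n. g j * z j)"
      by (simp add: H algebra_simps sum_subtractf sum_distrib_left)
    ultimately show ?thesis using IH(3) that by (simp add: y)
  qed
  have ann: "(\<Sum>i<n. A q i * H i j) = 0" if "q < Suc p" "j < n" for q j
  proof -
    have split: "(\<Sum>i<n. A q i * H i j) =
        (\<Sum>i<n. A q i * H0 i j) - (\<Sum>i<n. A q i * g i) * (g j / d)"
      by (simp add: H algebra_simps sum_subtractf sum_distrib_left)
    show ?thesis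
    proof (cases "q = p")
      case True
      then have "(\<Sum>i<n. A q i * H0 i j) = g j" "(\<Sum>i<n. A q i * g i) = d"
        using that by (simp_all add: g' d_def a_def)
      then show ?thesis
        unfolding split using g0[OF _ that(2)] by (cases "d = 0") simp_all
    next
      case False
      with that have "q < p" by simp
      have "(\<Sum>i<n. A q i * g i) = (\<Sum>j<n. (\<Sum>i<n. A q i * H0 i j) * a j)"
        unfolding g_def sum_distrib_left sum_distrib_right
        by (subst sum.swap) (simp add: mult_ac)
      then show ?thesis
        unfolding split using IH(4) \<open>q < p\<close> that by simp
    qed
  qed
  show ?case using sym idem res ann by blast
qed

lemma sweep_solves:
  assumes sol: "\<And>p. p < n \<Longrightarrow> (\<Sum>j<n. A p j * z j) = b p" and "p < n"
  shows "(\<Sum>j<n. A p j * snd (sweep n) j) = b p"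
proof -
  obtain H y where Hy: "sweep n = (H, y)" by fastforce
  note inv = sweep_invariant[OF sol Hy]
  have "(\<Sum>j<n. A p j * y j) = (\<Sum>i<n. A p i * (z i - (\<Sum>j<n. H i j * z j)))"
    using inv by simp
  also have "\<dots> = (\<Sum>j<n. A p j * z j) - (\<Sum>i<n. A p i * (\<Sum>j<n. H i j * z j))"
    by (simp add: right_diff_distrib sum_subtractf)
  also have "(\<Sum>i<n. A p i * (\<Sum>j<n. H i j * z j)) = (\<Sum>j<n. (\<Sum>i<n. A p i * H i j) * z j)"
    unfolding sum_distrib_left sum_distrib_right by (subst sum.swap) (simp add: mult_ac)
  also have "(\<Sum>j<n. (\<Sum>i<n. A p i * H i j) * z j) = 0"
  proof (intro sum.neutral ballI)
    fix j assume "j \<in> {..<n}"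
    then have "(\<Sum>i<n. A p i * H i j) = 0" using inv \<open>p < n\<close> by blast
    then show "(\<Sum>i<n. A p i * H i j) * z j = 0" by simp
  qed
  finally show ?thesis using assms by (simp add: Hy)
qed

end

section \<open>The program and its effect\<close>

abbreviation entry :: "name \<Rightarrow> nexp \<Rightarrow> rexp" where
  "entry a i \<equiv> RCell a i (NConst 0)"

abbreviation assign :: "name \<Rightarrow> nexp \<Rightarrow> rexp \<Rightarrow> com" where
  "assign a i e \<equiv> RAssign a i (NConst 0) e"

text \<open>The default \<open>k\<close> makes the subsequent copy the identity when no node in range has the row.
  The temporary \<open>t\<close> is cleared because a reception from outside the range leaves it unchanged.\<close>

definition find_source :: com where
  "find_source =
     Seq (NAssign ''src'' (NVar ''k''))
    (For ''j'' (NVar ''n'')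
      (Seq (assign ''t'' (NConst 0) (RConst 0))
      (Seq (Recv ''t'' (NConst 0) (NConst 0) (NVar ''j'') ''M'' (NVar ''s'') (NVar ''s''))
      (Cond (RLess (RConst 0) (entry ''t'' (NConst 0)))
         (NAssign ''src'' (NVar ''j''))
         Skip))))"

definition copy_row :: com where
  "copy_row =
     Seq (For ''j'' (NVar ''n'')
       (Recv ''M'' (NVar ''s'') (NVar ''j'') (NVar ''src'') ''M'' (NVar ''s'') (NVar ''j'')))
     (Recv ''b'' (NVar ''s'') (NConst 0) (NVar ''src'') ''b'' (NVar ''s'') (NConst 0))"

definition gather :: com where
  "gather = For ''s'' (NVar ''n'') (Seq find_source copy_row)"

definition reset :: com where
  "reset = For ''i'' (NVar ''n'')
     (Seq (assign ''y'' (NVar ''i'') (RConst 0))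
     (Seq (For ''j'' (NVar ''n'') (RAssign ''H'' (NVar ''i'') (NVar ''j'') (RConst 0)))
     (RAssign ''H'' (NVar ''i'') (NVar ''i'') (RConst 1))))"

text \<open>For row \<open>p\<close> of the system, \<open>g\<close> becomes the new direction, \<open>d\<close> its squared length, and \<open>e\<close>
  the residual of the equation at the current iterate.\<close>

definition project_row :: com where
  "project_row =
     Seq (assign ''d'' (NConst 0) (RConst 0))
    (Seq (assign ''e'' (NConst 0) (entry ''b'' (NVar ''p'')))
    (For ''i'' (NVar ''n'')
      (Seq (assign ''g'' (NVar ''i'') (RConst 0))
      (Seq (For ''j'' (NVar ''n'')
        (assign ''g'' (NVar ''i'')
          (RAdd (entry ''g'' (NVar ''i''))
            (RMul (RCell ''H'' (NVar ''i'') (NVar ''j'')) (RCell ''M'' (NVar ''p'') (NVar ''j''))))))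
      (Seq (assign ''d'' (NConst 0)
        (RAdd (entry ''d'' (NConst 0))
          (RMul (RCell ''M'' (NVar ''p'') (NVar ''i'')) (entry ''g'' (NVar ''i'')))))
      (assign ''e'' (NConst 0)
        (RSub (entry ''e'' (NConst 0))
          (RMul (RCell ''M'' (NVar ''p'') (NVar ''i'')) (entry ''y'' (NVar ''i''))))))))))"

definition update :: com where
  "update = For ''i'' (NVar ''n'')
     (Seq (assign ''y'' (NVar ''i'')
       (RAdd (entry ''y'' (NVar ''i''))
         (RDiv (RMul (entry ''g'' (NVar ''i'')) (entry ''e'' (NConst 0)))
           (entry ''d'' (NConst 0)))))
     (For ''j'' (NVar ''n'')
       (RAssign ''H'' (NVar ''i'') (NVar ''j'')
         (RSub (RCell ''H'' (NVar ''i'') (NVar ''j''))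
           (RDiv (RMul (entry ''g'' (NVar ''i'')) (entry ''g'' (NVar ''j'')))
             (entry ''d'' (NConst 0)))))))"

definition solve :: com where
  "solve =
     Seq reset
    (Seq (For ''p'' (NVar ''n'') (Seq project_row update))
    (Seq (assign ''x'' (NConst 0) (entry ''y'' (NVar ''k'')))
    (NAssign ''halt'' (NConst 1))))"

text \<open>The test is taken after the round counter has been increased, so that the elimination runs in
  the \<open>n\<close>-th round and only then.\<close>

definition program :: com where
  "program =
     Seq gather
    (Seq (NAssign ''r'' (NAdd (NVar ''r'') (NConst 1)))
    (Cond (NLess (NVar ''r'') (NVar ''n'')) Skip solve))"

lemma footprints [simp]:
  "assigned find_source = {''src'', ''j''}" "written find_source = {''t''}"
  "assigned copy_row = {''j''}" "written copy_row = {''M'', ''b''}"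
  "assigned gather = {''s'', ''src'', ''j''}" "written gather = {''t'', ''M'', ''b''}"
  "assigned reset = {''i'', ''j''}" "written reset = {''y'', ''H''}"
  "assigned project_row = {''i'', ''j''}" "written project_row = {''d'', ''e'', ''g''}"
  "assigned update = {''i'', ''j''}" "written update = {''y'', ''H''}"
  by (auto simp: find_source_def copy_row_def gather_def reset_def project_row_def update_def)

lemma bounded_loops_program:
  "bounded_loops gather" "bounded_loops solve"
  by (simp_all add: find_source_def copy_row_def gather_def reset_def project_row_def update_def
      solve_def)

lemma max_steps_gather:
  assumes "n > 0"
  shows "max_steps n gather \<le> 100 * n\<^sup>2"
proof -
  have "n \<le> n\<^sup>2" "1 \<le> n\<^sup>2"
    using assms by (simp_all add: power2_eq_square)
  moreover have "n * n = n\<^sup>2"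
    by (simp add: power2_eq_square)
  ultimately show ?thesis
    by (simp add: find_source_def copy_row_def gather_def distrib_left)
qed

lemma max_steps_solve:
  assumes "n > 0"
  shows "max_steps n solve \<le> 200 * n ^ 3"
proof -
  have "n \<le> n ^ 3" "n * n \<le> n ^ 3" "1 \<le> n ^ 3"
    using assms by (simp_all add: power3_eq_cube)
  moreover have "n * (n * n) = n ^ 3"
    by (simp add: power3_eq_cube)
  ultimately show ?thesis
    by (simp add: reset_def project_row_def update_def solve_def distrib_left)
qed

definition offers :: "(nat \<Rightarrow> memory option) \<Rightarrow> nat \<Rightarrow> nat \<Rightarrow> bool" where
  "offers peers s j \<longleftrightarrow> (\<exists>m. peers j = Some m \<and> m ''M'' s s > 0)"

lemma exec_find_source:
  fixes t :: node and peers :: "nat \<Rightarrow> memory option"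
  defines "q \<equiv> nvar (exec find_source peers t) ''src''"
  shows "q = nvar t ''k'' \<or> offers peers (nvar t ''s'') q"
    and "\<And>j. j < nvar t ''n'' \<Longrightarrow> offers peers (nvar t ''s'') j \<Longrightarrow>
      offers peers (nvar t ''s'') q"
proof -
  let ?n = "nvar t ''n''" and ?s = "nvar t ''s''" and ?k = "nvar t ''k''"
  let ?P = "\<lambda>v u. let q = nvar u ''src'' in (q = ?k \<or> offers peers ?s q) \<and>
    (\<forall>j<v. offers peers ?s j \<longrightarrow> offers peers ?s q)"
  have "?P ?n (exec find_source peers t)"
    unfolding find_source_def exec.simps(5)
  proof (induction rule: exec_For_induct[where P = ?P])
    case (step v u)
    have [simp]: "nvar u ''s'' = ?s"
      using step(3)[of "''s''"] by simp
    show ?case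
      using step(2) by (auto simp: Let_def offers_def less_Suc_eq split: option.splits)
  qed simp_all
  then show "q = ?k \<or> offers peers ?s q"
    and "\<And>j. j < ?n \<Longrightarrow> offers peers ?s j \<Longrightarrow> offers peers ?s q"
    unfolding q_def Let_def by blast+
qed

lemma exec_copy_row:
  assumes "peers (nvar t ''src'') = Some m"
  shows "cell (exec copy_row peers t) ''M'' i l =
      (if i = nvar t ''s'' \<and> l < nvar t ''n'' then m ''M'' i l else cell t ''M'' i l)"
    and "cell (exec copy_row peers t) ''b'' i l =
      (if i = nvar t ''s'' \<and> l = 0 then m ''b'' i l else cell t ''b'' i l)"
proof -
  let ?n = "nvar t ''n''" and ?s = "nvar t ''s''"
  define loop where "loop = For ''j'' (NVar ''n'')
       (Recv ''M'' (NVar ''s'') (NVar ''j'') (NVar ''src'') ''M'' (NVar ''s'') (NVar ''j''))"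
  let ?P = "\<lambda>v u. cell u ''M'' = (\<lambda>i l. if i = ?s \<and> l < v then m ''M'' i l else cell t ''M'' i l)"
  have "?P ?n (exec loop peers t)"
    unfolding loop_def
  proof (induction rule: exec_For_induct[where P = ?P])
    case (step v u)
    have [simp]: "nvar u ''s'' = ?s" "nvar u ''src'' = nvar t ''src''"
      using step(3)[of "''s''"] step(3)[of "''src''"] by simp_all
    show ?case
      using step(2) assms by (auto simp: fun_eq_iff less_Suc_eq)
  qed simp_all
  moreover have "nvar (exec loop peers t) x = nvar t x" if "x \<noteq> ''j''" for x
    using that by (intro nvar_exec) (simp add: loop_def)
  moreover have "cell (exec loop peers t) ''b'' = cell t ''b''"
    by (intro cell_exec) (simp add: loop_def)
  ultimately show "cell (exec copy_row peers t) ''M'' i l =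
      (if i = ?s \<and> l < ?n then m ''M'' i l else cell t ''M'' i l)"
    and "cell (exec copy_row peers t) ''b'' i l =
      (if i = ?s \<and> l = 0 then m ''b'' i l else cell t ''b'' i l)"
    using assms by (simp_all add: copy_row_def flip: loop_def)
qed

text \<open>The node \<open>q\<close> depends on the row \<open>s\<close>: it is one that has the row if there is any in range,
  and the node itself otherwise. All data is read from the memories at the start of the round, so
  the order in which the rows are treated does not matter.\<close>

lemma exec_gather:
  assumes self: "peers (nvar t ''k'') \<noteq> None" and "s < nvar t ''n''"
  shows "\<exists>q m. peers q = Some m \<and> (q = nvar t ''k'' \<or> offers peers s q) \<and>
    (\<forall>j<nvar t ''n''. offers peers s j \<longrightarrow> offers peers s q) \<and>
    (\<forall>l<nvar t ''n''. cell (exec gather peers t) ''M'' s l = m ''M'' s l) \<and>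
    cell (exec gather peers t) ''b'' s 0 = m ''b'' s 0"
proof -
  let ?n = "nvar t ''n''" and ?k = "nvar t ''k''"
  let ?R = "\<lambda>s u. \<exists>q m. peers q = Some m \<and> (q = ?k \<or> offers peers s q) \<and>
    (\<forall>j<?n. offers peers s j \<longrightarrow> offers peers s q) \<and>
    (\<forall>l<?n. cell u ''M'' s l = m ''M'' s l) \<and> cell u ''b'' s 0 = m ''b'' s 0"
  have "\<forall>s<?n. ?R s (exec gather peers t)"
    unfolding gather_def
  proof (induction rule: exec_For_induct[where P = "\<lambda>v u. \<forall>s<v. ?R s u"])
    case (step v u)
    have [simp]: "nvar u ''n'' = ?n" "nvar u ''k'' = ?k"
      using step(3)[of "''n''"] step(3)[of "''k''"] by simp_all
    let ?u0 = "tick 1 (set_nvar ''s'' v u)"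
    define u1 where "u1 = exec find_source peers ?u0"
    define u2 where "u2 = exec copy_row peers u1"
    have [simp]: "nvar u1 ''s'' = v" "nvar u1 ''n'' = ?n"
      "cell u1 ''M'' = cell u ''M''" "cell u1 ''b'' = cell u ''b''"
      by (simp_all add: u1_def nvar_exec cell_exec)
    let ?q = "nvar u1 ''src''"
    have q: "?q = ?k \<or> offers peers v ?q" "\<forall>j<?n. offers peers v j \<longrightarrow> offers peers v ?q"
      using exec_find_source[where peers = peers and t = ?u0, folded u1_def] by simp_all
    then obtain m where m: "peers ?q = Some m"
      using self by (auto simp: offers_def)
    note row = exec_copy_row[where peers = peers and t = u1 and m = m, OF m, folded u2_def]
    have "?R v u2"
      using q m by (intro exI[of _ ?q] exI[of _ m]) (simp add: row)
    moreover have "?R s u2" if "s < v" for s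
      using step(2) that by (simp add: row)
    ultimately show ?case
      by (simp only: exec.simps less_Suc_eq u1_def u2_def) blast
  qed simp_all
  then show ?thesis using assms(2) by blast
qed

lemma exec_reset:
  assumes "i < nvar t ''n''"
  shows "cell (exec reset peers t) ''y'' i 0 = 0"
    and "j < nvar t ''n'' \<Longrightarrow> cell (exec reset peers t) ''H'' i j = (if i = j then 1 else 0)"
proof -
  let ?n = "nvar t ''n''"
  let ?P = "\<lambda>v u. \<forall>i<v. cell u ''y'' i 0 = 0 \<and>
    (\<forall>j<?n. cell u ''H'' i j = (if i = j then 1 else 0))"
  define loop where
    "loop = For ''j'' (NVar ''n'') (RAssign ''H'' (NVar ''i'') (NVar ''j'') (RConst 0))"
  have loop: "cell (exec loop peers u) ''H'' = (\<lambda>i j.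
      if i = nvar u ''i'' \<and> j < nvar u ''n'' then 0 else cell u ''H'' i j)" for u
    unfolding loop_def
  proof (induction rule: exec_For_induct[where P = "\<lambda>v w. cell w ''H'' = (\<lambda>i j.
      if i = nvar u ''i'' \<and> j < v then 0 else cell u ''H'' i j)"])
    case (step v w)
    then show ?case
      using step(3)[of "''i''"] by (auto simp: fun_eq_iff less_Suc_eq)
  qed simp_all
  have [simp]: "nvar (exec loop peers u) x = nvar u x" if "x \<noteq> ''j''" for u x
    using that by (intro nvar_exec) (simp add: loop_def)
  have [simp]: "cell (exec loop peers u) ''y'' = cell u ''y''" for u
    by (intro cell_exec) (simp add: loop_def)
  have "?P ?n (exec reset peers t)"
    unfolding reset_def loop_def[symmetric]
  proof (induction rule: exec_For_induct[where P = ?P])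
    case (step v u)
    have [simp]: "nvar u ''n'' = ?n"
      using step(3)[of "''n''"] by (simp add: loop_def)
    show ?case
      using step(2) by (auto simp: loop less_Suc_eq)
  qed simp_all
  then show "cell (exec reset peers t) ''y'' i 0 = 0"
    and "j < ?n \<Longrightarrow> cell (exec reset peers t) ''H'' i j = (if i = j then 1 else 0)"
    using assms by blast+
qed

lemma exec_project_row:
  fixes t :: node and peers :: "nat \<Rightarrow> memory option"
  defines "g \<equiv> \<lambda>i. \<Sum>j<nvar t ''n''. cell t ''H'' i j * cell t ''M'' (nvar t ''p'') j"
  shows "i < nvar t ''n'' \<Longrightarrow> cell (exec project_row peers t) ''g'' i 0 = g i"
    and "cell (exec project_row peers t) ''d'' 0 0 =
      (\<Sum>i<nvar t ''n''. cell t ''M'' (nvar t ''p'') i * g i)"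
    and "cell (exec project_row peers t) ''e'' 0 0 = cell t ''b'' (nvar t ''p'') 0 -
      (\<Sum>i<nvar t ''n''. cell t ''M'' (nvar t ''p'') i * cell t ''y'' i 0)"
proof -
  let ?n = "nvar t ''n''" and ?p = "nvar t ''p''"
  let ?a = "cell t ''M'' ?p"
  define loop where "loop = For ''j'' (NVar ''n'')
        (assign ''g'' (NVar ''i'')
          (RAdd (entry ''g'' (NVar ''i''))
            (RMul (RCell ''H'' (NVar ''i'') (NVar ''j'')) (RCell ''M'' (NVar ''p'') (NVar ''j'')))))"
  have loop: "cell (exec loop peers u) ''g'' i 0 =
      (if i = nvar u ''i''
       then cell u ''g'' i 0 + (\<Sum>j<nvar u ''n''. cell u ''H'' i j * cell u ''M'' (nvar u ''p'') j)
       else cell u ''g'' i 0)" for u i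
    unfolding loop_def
  proof (induction rule: exec_For_induct[where P = "\<lambda>v w. cell w ''g'' i 0 =
      (if i = nvar u ''i''
       then cell u ''g'' i 0 + (\<Sum>j<v. cell u ''H'' i j * cell u ''M'' (nvar u ''p'') j)
       else cell u ''g'' i 0)"])
    case (step v w)
    have [simp]: "nvar w ''i'' = nvar u ''i''" "nvar w ''p'' = nvar u ''p''"
      "cell w ''H'' = cell u ''H''" "cell w ''M'' = cell u ''M''"
      using step(3)[of "''i''"] step(3)[of "''p''"] step(4)[of "''H''"] step(4)[of "''M''"]
      by simp_all
    show ?case
      using step(2) by (cases "i = nvar u ''i''") simp_all
  qed simp_all
  have [simp]: "nvar (exec loop peers u) x = nvar u x" if "x \<noteq> ''j''" for u x
    using that by (intro nvar_exec) (simp add: loop_def)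
  have [simp]: "cell (exec loop peers u) a = cell u a" if "a \<noteq> ''g''" for u a
    using that by (intro cell_exec) (simp add: loop_def)
  have [simp]: "assigned loop = {''j''}" "written loop = {''g''}"
    by (simp_all add: loop_def)
  let ?P = "\<lambda>v u. (\<forall>i<v. cell u ''g'' i 0 = g i) \<and>
    cell u ''d'' 0 0 = (\<Sum>i<v. ?a i * g i) \<and>
    cell u ''e'' 0 0 = cell t ''b'' ?p 0 - (\<Sum>i<v. ?a i * cell t ''y'' i 0)"
  have "?P ?n (exec project_row peers t)"
    unfolding project_row_def loop_def[symmetric] exec.simps(5)
  proof (induction rule: exec_For_induct[where P = ?P])
    case (step v u)
    have [simp]: "nvar u ''n'' = ?n" "nvar u ''p'' = ?p"
      "cell u ''H'' = cell t ''H''" "cell u ''M'' = cell t ''M''" "cell u ''y'' = cell t ''y''"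
      using step(3)[of "''n''"] step(3)[of "''p''"] step(4)[of "''H''"] step(4)[of "''M''"]
        step(4)[of "''y''"]
      by simp_all
    show ?case
      using step(2) by (auto simp: loop less_Suc_eq g_def)
  qed simp_all
  then show "i < ?n \<Longrightarrow> cell (exec project_row peers t) ''g'' i 0 = g i"
    and "cell (exec project_row peers t) ''d'' 0 0 = (\<Sum>i<?n. ?a i * g i)"
    and "cell (exec project_row peers t) ''e'' 0 0 =
      cell t ''b'' ?p 0 - (\<Sum>i<?n. ?a i * cell t ''y'' i 0)"
    by blast+
qed

lemma exec_update:
  assumes "i < nvar t ''n''"
  shows "cell (exec update peers t) ''y'' i 0 =
      cell t ''y'' i 0 + cell t ''g'' i 0 * cell t ''e'' 0 0 / cell t ''d'' 0 0"
    and "j < nvar t ''n'' \<Longrightarrow> cell (exec update peers t) ''H'' i j =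
      cell t ''H'' i j - cell t ''g'' i 0 * cell t ''g'' j 0 / cell t ''d'' 0 0"
proof -
  let ?n = "nvar t ''n''"
  let ?y = "\<lambda>i. cell t ''y'' i 0 + cell t ''g'' i 0 * cell t ''e'' 0 0 / cell t ''d'' 0 0"
  let ?H = "\<lambda>t i j. cell t ''H'' i j - cell t ''g'' i 0 * cell t ''g'' j 0 / cell t ''d'' 0 0"
  define loop where "loop = For ''j'' (NVar ''n'')
       (RAssign ''H'' (NVar ''i'') (NVar ''j'')
         (RSub (RCell ''H'' (NVar ''i'') (NVar ''j''))
           (RDiv (RMul (entry ''g'' (NVar ''i'')) (entry ''g'' (NVar ''j'')))
             (entry ''d'' (NConst 0)))))"
  have loop: "cell (exec loop peers u) ''H'' = (\<lambda>i j.
      if i = nvar u ''i'' \<and> j < nvar u ''n'' then ?H u i j else cell u ''H'' i j)" for u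
    unfolding loop_def
  proof (induction rule: exec_For_induct[where P = "\<lambda>v w. cell w ''H'' = (\<lambda>i j.
      if i = nvar u ''i'' \<and> j < v then ?H u i j else cell u ''H'' i j)"])
    case (step v w)
    have [simp]: "nvar w ''i'' = nvar u ''i''"
      "cell w ''g'' = cell u ''g''" "cell w ''d'' = cell u ''d''"
      using step(3)[of "''i''"] step(4)[of "''g''"] step(4)[of "''d''"] by simp_all
    show ?case
      using step(2) by (auto simp: fun_eq_iff less_Suc_eq)
  qed simp_all
  have [simp]: "nvar (exec loop peers u) x = nvar u x" if "x \<noteq> ''j''" for u x
    using that by (intro nvar_exec) (simp add: loop_def)
  have [simp]: "cell (exec loop peers u) a = cell u a" if "a \<noteq> ''H''" for u a
    using that by (intro cell_exec) (simp add: loop_def)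
  have [simp]: "assigned loop = {''j''}" "written loop = {''H''}"
    by (simp_all add: loop_def)
  let ?P = "\<lambda>v u. \<forall>i. cell u ''y'' i 0 = (if i < v then ?y i else cell t ''y'' i 0) \<and>
    (\<forall>j<?n. cell u ''H'' i j = (if i < v then ?H t i j else cell t ''H'' i j))"
  have "?P ?n (exec update peers t)"
    unfolding update_def loop_def[symmetric]
  proof (induction rule: exec_For_induct[where P = ?P])
    case (step v u)
    have [simp]: "nvar u ''n'' = ?n" "cell u ''g'' = cell t ''g''" "cell u ''d'' = cell t ''d''"
      "cell u ''e'' = cell t ''e''"
      using step(3)[of "''n''"] step(4)[of "''g''"] step(4)[of "''d''"] step(4)[of "''e''"]
      by simp_all
    show ?case
      using step(2) by (auto simp: loop less_Suc_eq)
  qed simp_all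
  then show "cell (exec update peers t) ''y'' i 0 = ?y i"
    and "j < ?n \<Longrightarrow> cell (exec update peers t) ''H'' i j = ?H t i j"
    using assms by auto
qed

lemma exec_solve:
  assumes n: "nvar t ''n'' = n" and k: "nvar t ''k'' < n"
    and A: "\<And>p j. p < n \<Longrightarrow> j < n \<Longrightarrow> cell t ''M'' p j = A p j"
    and b: "\<And>p. p < n \<Longrightarrow> cell t ''b'' p 0 = b p"
  shows "out_val (exec solve peers t) = snd (sweep n A b n) (nvar t ''k'')"
    and "halted (exec solve peers t)"
proof -
  let ?u = "exec reset peers t"
  let ?loop = "For ''p'' (NVar ''n'') (Seq project_row update)"
  let ?P = "\<lambda>v w. (\<forall>i<n. cell w ''y'' i 0 = snd (sweep n A b v) i) \<and>
    (\<forall>i<n. \<forall>j<n. cell w ''H'' i j = fst (sweep n A b v) i j)"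
  have u [simp]: "nvar ?u ''n'' = n" "nvar ?u ''k'' = nvar t ''k''"
    "cell ?u ''M'' = cell t ''M''" "cell ?u ''b'' = cell t ''b''"
    using n by (simp_all add: nvar_exec cell_exec)
  have "?P n (exec ?loop peers ?u)"
  proof (induction rule: exec_For_induct[where P = ?P])
    case init
    show ?case using exec_reset[where t = t and peers = peers] n by simp
  next
    case (step v w)
    have w [simp]: "nvar w ''n'' = n" "cell w ''M'' = cell t ''M''" "cell w ''b'' = cell t ''b''"
      using step(3)[of "''n''"] step(4)[of "''M''"] step(4)[of "''b''"] by simp_all
    let ?w = "tick 1 (set_nvar ''p'' v w)"
    define x where "x = exec project_row peers ?w"
    obtain H y where Hy: "sweep n A b v = (H, y)" by fastforce
    let ?g = "\<lambda>i. \<Sum>j<n. H i j * A v j"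
    have x [simp]: "nvar x ''n'' = n" "cell x ''y'' = cell w ''y''" "cell x ''H'' = cell w ''H''"
      by (simp_all add: x_def nvar_exec cell_exec)
    have yH: "cell w ''y'' i 0 = y i" "j < n \<Longrightarrow> cell w ''H'' i j = H i j" if "i < n" for i j
      using step(2) Hy that by auto
    have g: "cell x ''g'' i 0 = ?g i" if "i < n" for i
      using exec_project_row(1)[where i = i and peers = peers and t = ?w] that step(1) by (simp add: x_def A yH)
    have d: "cell x ''d'' 0 0 = (\<Sum>i<n. A v i * ?g i)"
      using exec_project_row(2)[where peers = peers and t = ?w] step(1) by (simp add: x_def A yH)
    have e: "cell x ''e'' 0 0 = b v - (\<Sum>i<n. A v i * y i)"
      using exec_project_row(3)[where peers = peers and t = ?w] step(1) by (simp add: x_def A b yH)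
    have "exec (Seq project_row update) peers ?w = exec update peers x"
      by (simp only: x_def exec.simps)
    then show ?case
      using exec_update[where t = x and peers = peers] by (simp add: g d e yH Hy Let_def)
  qed simp_all
  moreover have "nvar (exec ?loop peers ?u) ''k'' = nvar t ''k''"
    by (subst nvar_exec) simp_all
  ultimately show "out_val (exec solve peers t) = snd (sweep n A b n) (nvar t ''k'')"
    and "halted (exec solve peers t)"
    using k by (simp_all only: solve_def exec.simps) (simp_all add: out_val_def halted_def)
qed

section \<open>Laplacians\<close>

context
  fixes n :: nat and E :: "(nat \<times> nat) set" and W :: "nat \<Rightarrow> nat \<Rightarrow> real"
  assumes graph: "weighted_graph n E W"
begin

lemma edge_bound: "(i, j) \<in> E \<Longrightarrow> i < n \<and> j < n"
  using graph by (auto simp: weighted_graph_def)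

lemma no_loop: "(i, i) \<notin> E"
  using graph by (auto simp: weighted_graph_def irrefl_def)

lemma edge_sym: "(i, j) \<in> E \<longleftrightarrow> (j, i) \<in> E"
  using graph by (auto simp: weighted_graph_def dest: symD)

lemma weight_pos: "(i, j) \<in> E \<Longrightarrow> W i j > 0"
  and weight_sym: "(i, j) \<in> E \<Longrightarrow> W i j = W j i"
  using graph by (auto simp: weighted_graph_def)

lemma finite_edges: "finite E"
  using graph finite_subset[of E "{..<n} \<times> {..<n}"] by (auto simp: weighted_graph_def)

lemma finite_neighbours: "finite {j. (i, j) \<in> E}"
  by (rule finite_subset[of _ "{..<n}"]) (auto dest: edge_bound)

lemma laplacian_carrier [simp]: "laplacian n E W \<in> carrier_mat n n"
  "dim_row (laplacian n E W) = n" "dim_col (laplacian n E W) = n"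
  by (simp_all add: laplacian_def)

lemma laplacian_mult_vec:
  assumes "x \<in> carrier_vec n" "i < n"
  shows "(laplacian n E W *\<^sub>v x) $ i = (\<Sum>j<n. laplacian n E W $$ (i, j) * x $ j)"
  using assms by (simp add: scalar_prod_def lessThan_atLeast0)

text \<open>A diagonal entry is a sum of positive weights, hence positive unless the vertex is isolated.
  This is why the diagonal can serve as the mark of an arrived row.\<close>

lemma laplacian_row_zero:
  assumes "\<not> laplacian n E W $$ (i, i) > 0" "i < n" "j < n"
  shows "laplacian n E W $$ (i, j) = 0"
proof -
  have "{l. (i, l) \<in> E} = {}"
  proof (rule ccontr)
    assume "{l. (i, l) \<in> E} \<noteq> {}"
    then have "(\<Sum>l | (i, l) \<in> E. W i l) > 0"
      using finite_neighbours weight_pos by (intro sum_pos) auto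
    with assms show False by (simp add: laplacian_def)
  qed
  with assms show ?thesis by (auto simp: laplacian_def)
qed

lemma laplacian_eq_0:
  assumes "i < n" "j < n" "(i, j) \<notin> E\<^sup>*"
  shows "laplacian n E W $$ (i, j) = 0"
  using assms by (auto simp: laplacian_def)

text \<open>The quadratic form is half the sum of \<open>W\<^sub>i\<^sub>j (x\<^sub>i - x\<^sub>j)\<^sup>2\<close> over the ordered pairs of
  adjacent vertices.\<close>

lemma laplacian_form_nonneg:
  assumes x: "x \<in> carrier_vec n"
  shows "x \<bullet> (laplacian n E W *\<^sub>v x) \<ge> 0"
proof -
  define w where "w i j = (if (i, j) \<in> E then W i j else 0)" for i j
  have w_nonneg: "w i j \<ge> 0" for i j
    using weight_pos[of i j] by (auto simp: w_def less_imp_le)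
  have w_sym: "w i j = w j i" for i j
    using edge_sym[of i j] weight_sym[of i j] by (simp add: w_def)
  have entry: "laplacian n E W $$ (i, j) = (if i = j then \<Sum>l<n. w i l else 0) - w i j"
    if "i < n" "j < n" for i j
  proof -
    have "(\<Sum>l | (i, l) \<in> E. W i l) = (\<Sum>l<n. w i l)"
      by (rule sum.mono_neutral_cong_left) (auto simp: w_def dest: edge_bound)
    then show ?thesis
      using that no_loop[of j] by (auto simp: laplacian_def w_def)
  qed
  have "(laplacian n E W *\<^sub>v x) $ i = (\<Sum>j<n. w i j * (x $ i - x $ j))" if "i < n" for i
  proof -
    have "(laplacian n E W *\<^sub>v x) $ i =
        (\<Sum>j<n. (if i = j then (\<Sum>l<n. w i l) * x $ j else 0) - w i j * x $ j)"
      unfolding laplacian_mult_vec[OF x that]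
      by (rule sum.cong) (auto simp: entry that left_diff_distrib)
    then show ?thesis
      using that by (simp add: sum_subtractf right_diff_distrib sum_distrib_right)
  qed
  then have "x \<bullet> (laplacian n E W *\<^sub>v x) = (\<Sum>i<n. \<Sum>j<n. w i j * (x $ i - x $ j) * x $ i)"
    using x by (simp add: scalar_prod_def lessThan_atLeast0 sum_distrib_right mult.commute[of "x $ _"])
  moreover have "(\<Sum>i<n. \<Sum>j<n. w i j * (x $ i - x $ j) * x $ i) =
      (\<Sum>i<n. \<Sum>j<n. w i j * (x $ j - x $ i) * x $ j)"
    by (subst sum.swap) (simp add: w_sym)
  ultimately have "2 * (x \<bullet> (laplacian n E W *\<^sub>v x)) =
      (\<Sum>i<n. \<Sum>j<n. w i j * (x $ i - x $ j) * x $ i + w i j * (x $ j - x $ i) * x $ j)"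
    by (simp add: sum.distrib)
  also have "\<dots> = (\<Sum>i<n. \<Sum>j<n. w i j * (x $ i - x $ j)\<^sup>2)"
    by (intro sum.cong) (simp_all add: power2_eq_square algebra_simps)
  also have "\<dots> \<ge> 0"
    by (intro sum_nonneg mult_nonneg_nonneg w_nonneg) simp
  finally show ?thesis by simp
qed

lemma exact_solution_approx:
  assumes y: "y \<in> carrier_vec n" "laplacian n E W *\<^sub>v y = b" and "\<epsilon> \<ge> 0"
  shows "approx_solution (laplacian n E W) b \<epsilon> y"
  unfolding approx_solution_def
proof (intro ballI impI)
  let ?L = "laplacian n E W"
  fix x assume "x \<in> carrier_vec (dim_col ?L)" and "?L *\<^sub>v x = b"
  then have x: "x \<in> carrier_vec n" by simp
  have "?L *\<^sub>v (x - y) = ?L *\<^sub>v x - ?L *\<^sub>v y"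
    using x y(1) by (intro mult_minus_distrib_mat_vec[of _ n n]) simp_all
  also have "\<dots> = 0\<^sub>v n"
    using y \<open>?L *\<^sub>v x = b\<close> by auto
  finally have "energy_norm ?L (x - y) = 0"
    using x y(1) by (simp add: energy_norm_def)
  moreover have "energy_norm ?L x \<ge> 0"
    using laplacian_form_nonneg[OF x] by (simp add: energy_norm_def)
  ultimately show "energy_norm ?L (x - y) \<le> \<epsilon> * energy_norm ?L x"
    using \<open>\<epsilon> \<ge> 0\<close> by simp
qed

text \<open>The vector computed by node \<open>k\<close>, which knows only the equations of its component; all
  other equations read \<open>0 = 0\<close>.\<close>

definition component_solution :: "real vec \<Rightarrow> nat \<Rightarrow> nat \<Rightarrow> real" where
  "component_solution b k = snd (sweep n
     (\<lambda>p j. if (k, p) \<in> E\<^sup>* then laplacian n E W $$ (p, j) else 0)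
     (\<lambda>p. if (k, p) \<in> E\<^sup>* then b $ p else 0) n)"

text \<open>Row \<open>i\<close> of the Laplacian involves only entries \<open>j\<close> in the component of \<open>i\<close>, and all these
  nodes have computed the same vector. The entry that each of them contributes may thus be taken
  from the vector of node \<open>i\<close>, which satisfies equation \<open>i\<close>.\<close>

lemma component_solution_solves:
  assumes z: "z \<in> carrier_vec n" "laplacian n E W *\<^sub>v z = b"
  shows "laplacian n E W *\<^sub>v vec n (\<lambda>k. component_solution b k k) = b" (is "?L *\<^sub>v ?y = b")
proof (rule eq_vecI)
  have "dim_vec b = n" using z by auto
  then show "dim_vec (?L *\<^sub>v ?y) = dim_vec b" by simp
  fix i assume "i < dim_vec b"
  then have i: "i < n" using \<open>dim_vec b = n\<close> by simp
  have "sym (E\<^sup>*)"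
    using edge_sym by (intro sym_rtrancl symI) blast
  have same: "component_solution b j = component_solution b i" if "(i, j) \<in> E\<^sup>*" for j
  proof -
    have "(j, p) \<in> E\<^sup>* \<longleftrightarrow> (i, p) \<in> E\<^sup>*" for p
      using that \<open>sym (E\<^sup>*)\<close> by (meson rtrancl_trans symD)
    then show ?thesis by (simp add: component_solution_def)
  qed
  have "(?L *\<^sub>v ?y) $ i = (\<Sum>j<n. ?L $$ (i, j) * component_solution b j j)"
    by (subst laplacian_mult_vec) (simp_all add: i)
  also have "\<dots> = (\<Sum>j<n. ?L $$ (i, j) * component_solution b i j)"
  proof (rule sum.cong)
    fix j assume "j \<in> {..<n}"
    then show "?L $$ (i, j) * component_solution b j j = ?L $$ (i, j) * component_solution b i j"
      using same[of j] laplacian_eq_0[OF i, of j] by (cases "(i, j) \<in> E\<^sup>*") simp_all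
  qed simp
  also have "\<dots> = b $ i"
  proof -
    define A where "A = (\<lambda>p j. if (i, p) \<in> E\<^sup>* then ?L $$ (p, j) else 0)"
    define \<beta> where "\<beta> = (\<lambda>p. if (i, p) \<in> E\<^sup>* then b $ p else 0)"
    have "(\<Sum>j<n. A p j * z $ j) = \<beta> p" if "p < n" for p
      using laplacian_mult_vec[OF z(1) that] z(2) by (simp add: A_def \<beta>_def)
    then have "(\<Sum>j<n. A i j * snd (sweep n A \<beta> n) j) = \<beta> i"
      using i by (rule sweep_solves)
    moreover have "component_solution b i = snd (sweep n A \<beta> n)"
      by (simp add: component_solution_def A_def \<beta>_def)
    ultimately show ?thesis by (simp add: A_def \<beta>_def)
  qed
  finally show "(?L *\<^sub>v ?y) $ i = b $ i" .
qed

section \<open>Flooding\<close>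

definition hops :: "nat \<Rightarrow> (nat \<times> nat) set" where
  "hops R = {(k, j). k < n \<and> j \<in> hop_nbhd n E R k}"

lemma hops_subset_rtrancl: "hops R \<subseteq> E\<^sup>*"
proof
  fix x assume "x \<in> hops R"
  then obtain k j where x: "x = (k, j)" and "graph_dist E k j \<le> enat R"
    by (auto simp: hops_def hop_nbhd_def)
  have "graph_dist E k j = \<infinity>" if "(k, j) \<notin> E\<^sup>*"
  proof -
    have "{m. (k, j) \<in> E ^^ m} = {}"
      using that relpow_imp_rtrancl by blast
    then show ?thesis by (simp add: graph_dist_def top_enat_def)
  qed
  then show "x \<in> E\<^sup>*"
    using x \<open>graph_dist E k j \<le> enat R\<close> by (cases "(k, j) \<in> E\<^sup>*") simp_all
qed

lemma relpow_imp_hops: "(k, j) \<in> E ^^ m \<Longrightarrow> m \<le> R \<Longrightarrow> k < n \<Longrightarrow> j < n \<Longrightarrow> (k, j) \<in> hops R"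
  unfolding hops_def hop_nbhd_def graph_dist_def
  by (auto intro: INF_lower2[of m])

lemma hops_refl: "k < n \<Longrightarrow> (k, k) \<in> hops R"
  by (rule relpow_imp_hops[of _ _ 0]) auto

lemma rtrancl_imp_short_relpow:
  assumes "(k, j) \<in> E\<^sup>*" "k < n"
  obtains m where "m < n" "(k, j) \<in> E ^^ m"
proof -
  let ?r = "\<lambda>x y. (x, y) \<in> E"
  have "?r\<^sup>*\<^sup>* k j" using assms(1) by (simp add: rtrancl_def)
  then obtain xs where "rtrancl_path ?r k xs j"
    by (auto simp: rtranclp_eq_rtrancl_path)
  then obtain xs where xs: "rtrancl_path ?r k xs j" "distinct (k # xs)"
    by (rule rtrancl_path_distinct)
  have "set xs \<subseteq> {..<n} \<and> (k, j) \<in> E ^^ length xs"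
    using xs(1)
  proof induction
    case (step x y ys z)
    then show ?case
      using edge_bound relpow_Suc_I2[OF step(1)] by (auto simp del: relpow.simps)
  qed simp
  moreover from this have "card (set (k # xs)) \<le> card {..<n}"
    using assms(2) by (intro card_mono) auto
  ultimately show ?thesis
    using xs(2) that[of "length xs"] by (simp add: distinct_card)
qed

text \<open>Edges are hops as \<open>R \<ge> 1\<close>, and a path without repeated vertices has fewer than \<open>n\<close> edges;
  since a node is within its own range, shorter walks can be padded to length \<open>n\<close>. Conversely
  a hop never leaves a component.\<close>

lemma hops_relpow_iff:
  assumes "R \<ge> 1" "k < n" "j < n"
  shows "(k, j) \<in> hops R ^^ n \<longleftrightarrow> (k, j) \<in> E\<^sup>*"
proof
  assume "(k, j) \<in> hops R ^^ n"
  then have "(k, j) \<in> (E\<^sup>*)\<^sup>*"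
    using hops_subset_rtrancl by (meson relpow_imp_rtrancl rtrancl_mono subsetD)
  then show "(k, j) \<in> E\<^sup>*" by simp
next
  assume "(k, j) \<in> E\<^sup>*"
  then obtain m where m: "m < n" "(k, j) \<in> E ^^ m"
    using \<open>k < n\<close> by (rule rtrancl_imp_short_relpow)
  have "E \<subseteq> hops R"
    using edge_bound \<open>R \<ge> 1\<close> by (auto intro!: relpow_imp_hops[of _ _ 1])
  then have "(k, j) \<in> hops R ^^ m"
    using m(2) relpowp_mono[to_set, of E] by blast
  moreover have "(k, j) \<in> hops R ^^ (m + d)" if "(k, j) \<in> hops R ^^ m" for d
    using that
  proof (induction d)
    case (Suc d)
    then show ?case
      using relpow_Suc_I2[OF hops_refl[OF \<open>k < n\<close>]] by simp
  qed simp
  ultimately show "(k, j) \<in> hops R ^^ n"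
    using m(1) by (metis le_add_diff_inverse less_imp_le)
qed

text \<open>\<open>K\<close> is the set of indices whose rows have arrived.\<close>

definition holds_rows :: "real vec \<Rightarrow> nat set \<Rightarrow> memory \<Rightarrow> bool" where
  "holds_rows b K m \<longleftrightarrow> (\<forall>i<n.
     (\<forall>j<n. m ''M'' i j = (if i \<in> K then laplacian n E W $$ (i, j) else 0)) \<and>
     m ''b'' i 0 = (if i \<in> K then b $ i else 0))"

text \<open>After \<open>T\<close> rounds a node has the rows that it can reach by exactly \<open>T\<close> hops; staying put is a
  hop, so nothing is lost. For an isolated vertex the search finds no source, but then all
  versions of its row agree, being zero: consistency of the system forces a zero right-hand side.\<close>

lemma gather_holds_rows:
  assumes z: "z \<in> carrier_vec n" "laplacian n E W *\<^sub>v z = b"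
    and "nvar (\<sigma> k) ''n'' = n" "nvar (\<sigma> k) ''k'' = k" "k < n"
    and IH: "\<And>j. j < n \<Longrightarrow> holds_rows b ((hops R ^^ T) `` {j}) (cell (\<sigma> j))"
    and peers: "peers = (\<lambda>j. if j \<in> hop_nbhd n E R k then Some (cell (\<sigma> j)) else None)"
  shows "holds_rows b ((hops R ^^ Suc T) `` {k}) (cell (exec gather peers (\<sigma> k)))"
  unfolding holds_rows_def
proof (intro allI impI)
  let ?L = "laplacian n E W"
  fix i assume i: "i < n"
  have range: "peers j = Some m \<longleftrightarrow> (k, j) \<in> hops R \<and> m = cell (\<sigma> j)" for j m
    using \<open>k < n\<close> by (auto simp: peers hops_def)
  have bound: "j < n" if "(k, j) \<in> hops R" for j
    using that by (simp add: hops_def hop_nbhd_def)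
  have "peers (nvar (\<sigma> k) ''k'') \<noteq> None"
    using range hops_refl[OF \<open>k < n\<close>] assms(4) by auto
  from exec_gather[where peers = peers and t = "\<sigma> k" and s = i, OF this] obtain q m where "peers q = Some m"
    and q: "q = k \<or> offers peers i q" "\<And>j. j < n \<Longrightarrow> offers peers i j \<Longrightarrow> offers peers i q"
    and copy: "\<And>j. j < n \<Longrightarrow> cell (exec gather peers (\<sigma> k)) ''M'' i j = m ''M'' i j"
      "cell (exec gather peers (\<sigma> k)) ''b'' i 0 = m ''b'' i 0"
    using assms(3,4) i by auto
  then have kq: "(k, q) \<in> hops R" and m: "m = cell (\<sigma> q)"
    by (simp_all add: range)
  have row: "m ''M'' i j = (if (q, i) \<in> hops R ^^ T then ?L $$ (i, j) else 0)" if "j < n" for j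
    using IH[OF bound[OF kq]] i that by (simp add: m holds_rows_def)
  have rhs: "m ''b'' i 0 = (if (q, i) \<in> hops R ^^ T then b $ i else 0)"
    using IH[OF bound[OF kq]] i by (simp add: m holds_rows_def)
  have "(\<forall>j<n. ?L $$ (i, j) = 0) \<and> b $ i = 0 \<or>
    ((q, i) \<in> hops R ^^ T \<longleftrightarrow> (k, i) \<in> hops R ^^ Suc T)"
  proof (cases "?L $$ (i, i) > 0")
    case True
    have "offers peers i j \<longleftrightarrow> (k, j) \<in> hops R \<and> (j, i) \<in> hops R ^^ T" for j
      using True IH[of j] bound[of j] i by (auto simp: offers_def range holds_rows_def split: if_splits)
    then have "(q, i) \<in> hops R ^^ T \<longleftrightarrow> (k, i) \<in> hops R ^^ Suc T"
      using q(2) bound kq by (blast intro: relpow_Suc_I2 elim: relpow_Suc_E2)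
    then show ?thesis ..
  next
    case False
    then have "\<forall>j<n. ?L $$ (i, j) = 0"
      using laplacian_row_zero i by blast
    moreover from this have "b $ i = 0"
      using laplacian_mult_vec[OF z(1) i] z(2) by simp
    ultimately show ?thesis by blast
  qed
  then show "(\<forall>j<n. cell (exec gather peers (\<sigma> k)) ''M'' i j =
        (if i \<in> (hops R ^^ Suc T) `` {k} then ?L $$ (i, j) else 0)) \<and>
      cell (exec gather peers (\<sigma> k)) ''b'' i 0 =
        (if i \<in> (hops R ^^ Suc T) `` {k} then b $ i else 0)"
    by (auto simp: copy row rhs simp del: relpow.simps)
qed

lemma run_Suc:
  "run P n E R M b \<epsilon> (Suc T) k =
     (if halted (run P n E R M b \<epsilon> T k) then run P n E R M b \<epsilon> T k
      else exec P (\<lambda>j. if j \<in> hop_nbhd n E R k then Some (cell (run P n E R M b \<epsilon> T j)) else None)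
        (run P n E R M b \<epsilon> T k))"
  unfolding run_def by (simp add: one_round_def)

text \<open>The cost of a round that does not solve is at most \<open>100 n\<^sup>2\<close> for the communication and nine
  steps for increasing and testing the round counter.\<close>

lemma before_last_round:
  fixes R :: nat and \<epsilon> :: real
  assumes z: "z \<in> carrier_vec n" "laplacian n E W *\<^sub>v z = b"
    and "T < n" "k < n"
  defines "\<sigma> \<equiv> run program n E R (laplacian n E W) b \<epsilon>"
  shows "nvar (\<sigma> T k) ''n'' = n \<and> nvar (\<sigma> T k) ''k'' = k \<and> nvar (\<sigma> T k) ''r'' = T \<and>
    \<not> halted (\<sigma> T k) \<and> holds_rows b ((hops R ^^ T) `` {k}) (cell (\<sigma> T k)) \<and>
    steps (\<sigma> T k) \<le> T * (109 * n\<^sup>2)"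
  using \<open>T < n\<close> \<open>k < n\<close>
proof (induction T arbitrary: k)
  case 0
  then show ?case
    by (auto simp: \<sigma>_def run_def init_node_def halted_def holds_rows_def)
next
  case (Suc T)
  let ?s = "\<sigma> T k"
  define peers where
    "peers = (\<lambda>j. if j \<in> hop_nbhd n E R k then Some (cell (\<sigma> T j)) else None)"
  define u where "u = exec gather peers ?s"
  have s: "nvar ?s ''n'' = n" "nvar ?s ''k'' = k" "nvar ?s ''r'' = T" "\<not> halted ?s"
    "steps ?s \<le> T * (109 * n\<^sup>2)"
    using Suc by simp_all
  have "holds_rows b ((hops R ^^ Suc T) `` {k}) (cell u)"
    unfolding u_def
    using z s(1,2) \<open>k < n\<close> _ peers_def by (rule gather_holds_rows) (use Suc in auto)
  moreover have u: "nvar u x = nvar ?s x" if "x \<notin> {''s'', ''src'', ''j''}" for x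
    using that by (simp add: u_def nvar_exec)
  moreover have "steps u \<le> steps ?s + 100 * n\<^sup>2"
    using steps_exec[OF bounded_loops_program(1), of peers ?s] max_steps_gather[of n] s(1) \<open>k < n\<close>
    by (simp add: u_def)
  moreover have "\<sigma> (Suc T) k = exec program peers ?s"
    using s(4) unfolding \<sigma>_def peers_def run_Suc by simp
  then have "\<sigma> (Suc T) k = tick 9 (set_nvar ''r'' (Suc T) u)"
    using s Suc.prems by (simp add: program_def u u_def[symmetric])
  moreover have "9 \<le> 9 * n\<^sup>2"
    using \<open>k < n\<close> by simp
  ultimately show ?case
    using s by (simp add: halted_def)
qed

text \<open>The constant is made up of \<open>109 n\<^sup>2\<close> steps in each of the \<open>n\<close> rounds and \<open>200 n\<^sup>3\<close> steps for
  the elimination.\<close>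

lemma after_last_round:
  fixes R :: nat and \<epsilon> :: real
  assumes z: "z \<in> carrier_vec n" "laplacian n E W *\<^sub>v z = b"
    and "R \<ge> 1" "k < n"
  defines "\<sigma> \<equiv> run program n E R (laplacian n E W) b \<epsilon>"
  shows "halted (\<sigma> n k)" "out_val (\<sigma> n k) = component_solution b k k"
    "steps (\<sigma> n k) \<le> 309 * n ^ 3"
proof -
  obtain T where T: "n = Suc T"
    using \<open>k < n\<close> by (cases n) auto
  let ?s = "\<sigma> T k"
  define peers where
    "peers = (\<lambda>j. if j \<in> hop_nbhd n E R k then Some (cell (\<sigma> T j)) else None)"
  define u where "u = exec gather peers ?s"
  \<comment> \<open>The state in which the elimination starts: incrementing the counter and testing it cost
    four steps each.\<close>
  define v where "v = tick 8 (set_nvar ''r'' n u)"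
  note prev = before_last_round[OF z, of T _ R \<epsilon>, folded \<sigma>_def]
  have s: "nvar ?s ''n'' = n" "nvar ?s ''k'' = k" "nvar ?s ''r'' = T" "\<not> halted ?s"
    "steps ?s \<le> T * (109 * n\<^sup>2)"
    using prev[of k] T \<open>k < n\<close> by simp_all
  have "holds_rows b ((hops R ^^ Suc T) `` {k}) (cell u)"
    unfolding u_def
    using z s(1,2) \<open>k < n\<close> _ peers_def by (rule gather_holds_rows) (use prev T in auto)
  moreover have "i \<in> (hops R ^^ Suc T) `` {k} \<longleftrightarrow> (k, i) \<in> E\<^sup>*" if "i < n" for i
    using hops_relpow_iff[OF \<open>R \<ge> 1\<close> \<open>k < n\<close> that] T by simp
  ultimately have rows: "holds_rows b {i. (k, i) \<in> E\<^sup>*} (cell v)"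
    by (simp add: holds_rows_def v_def)
  have u: "nvar u x = nvar ?s x" if "x \<notin> {''s'', ''src'', ''j''}" for x
    using that by (simp add: u_def nvar_exec)
  then have v: "nvar v ''n'' = n" "nvar v ''k'' = k"
    using s by (simp_all add: v_def)
  have "\<sigma> (Suc T) k = exec program peers ?s"
    using s(4) unfolding \<sigma>_def peers_def run_Suc by simp
  then have last: "\<sigma> n k = exec solve peers v"
    using s T by (simp add: program_def u u_def[symmetric] v_def eval_nat_numeral)
  from rows have
    "\<And>p j. p < n \<Longrightarrow> j < n \<Longrightarrow>
      cell v ''M'' p j = (if (k, p) \<in> E\<^sup>* then laplacian n E W $$ (p, j) else 0)"
    "\<And>p. p < n \<Longrightarrow> cell v ''b'' p 0 = (if (k, p) \<in> E\<^sup>* then b $ p else 0)"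
    by (simp_all add: holds_rows_def)
  from exec_solve[OF v(1) _ this, of peers] show
    "halted (\<sigma> n k)" "out_val (\<sigma> n k) = component_solution b k k"
    using v(2) \<open>k < n\<close> by (simp_all add: last component_solution_def)
  have "steps u \<le> steps ?s + 100 * n\<^sup>2"
    using steps_exec[OF bounded_loops_program(1), of peers ?s] max_steps_gather[of n] s(1) \<open>k < n\<close>
    by (simp add: u_def)
  moreover have "8 \<le> 9 * n\<^sup>2"
  proof -
    have "1 \<le> n\<^sup>2" using \<open>k < n\<close> by simp
    then show ?thesis by linarith
  qed
  ultimately have "steps v \<le> Suc T * (109 * n\<^sup>2)"
    using s(5) by (simp add: v_def)
  also have "\<dots> = 109 * n ^ 3"
    by (simp only: T[symmetric]) (simp add: power2_eq_square power3_eq_cube)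
  finally show "steps (\<sigma> n k) \<le> 309 * n ^ 3"
    using steps_exec[OF bounded_loops_program(2), of peers v] max_steps_solve[of n] v(1) \<open>k < n\<close>
    by (simp add: last)
qed

end

section \<open>The time bound\<close>

text \<open>For \<open>d > 1\<close> the quotient is at least \<open>R + 1\<close>, by Bernoulli's inequality.\<close>

lemma nbhd_bound_ge:
  assumes "d \<ge> 1"
  shows "real (min R n) \<le> nbhd_bound n d R"
proof (cases "d = 1")
  case False
  with assms have d: "real d > 1" by simp
  have "1 + real (R + 1) * (real d - 1) \<le> (1 + (real d - 1)) ^ (R + 1)"
    using d by (intro Bernoulli_inequality) simp
  then have "real (R + 1) \<le> (real d ^ (R + 1) - 1) / (real d - 1)"
    using d by (simp add: pos_le_divide_eq)
  with False show ?thesis by (simp add: nbhd_bound_def)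
qed (simp add: nbhd_bound_def)

text \<open>Besides the cubic term, only the logarithm can be smaller than one, and it is at least
  \<open>ln 2\<close>.\<close>

lemma time_bound_ge:
  assumes graph: "weighted_graph n E W" and "E \<noteq> {}" "R \<ge> 1" "0 < \<epsilon>" "\<epsilon> \<le> 1 / 2"
  shows "real n ^ 3 * ln 2 \<le> real n ^ 3 * nbhd_bound n (max_degree n E) R / real (min R n)
    * (max_weight E W / min_weight E W) * ln (1 / \<epsilon>)"
proof -
  obtain i j where ij: "(i, j) \<in> E" using \<open>E \<noteq> {}\<close> by auto
  then have "i < n" using edge_bound[OF graph] by blast
  have "1 \<le> card {j. (i, j) \<in> E}"
    using ij finite_neighbours[OF graph] by (simp add: Suc_le_eq card_gt_0_iff) blast
  also have "\<dots> \<le> max_degree n E"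
    unfolding max_degree_def using \<open>i < n\<close> by (intro Max_ge) auto
  finally have "real (min R n) \<le> nbhd_bound n (max_degree n E) R"
    by (rule nbhd_bound_ge)
  then have 1: "1 \<le> nbhd_bound n (max_degree n E) R / real (min R n)"
    using \<open>i < n\<close> \<open>R \<ge> 1\<close> by (simp add: le_divide_eq_1)
  let ?V = "(\<lambda>(i, j). W i j) ` E"
  have V: "finite ?V" "W i j \<in> ?V"
    using finite_edges[OF graph] ij by auto
  then have "min_weight E W \<in> ?V"
    unfolding min_weight_def by (intro Min_in) auto
  then have "min_weight E W > 0"
    using weight_pos[OF graph] by auto
  moreover have "min_weight E W \<le> max_weight E W"
    unfolding min_weight_def max_weight_def using V Min_le Max_ge by (meson order_trans)
  ultimately have 2: "1 \<le> max_weight E W / min_weight E W"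
    by simp
  have 3: "ln 2 \<le> ln (1 / \<epsilon>)"
    using assms by (simp add: field_simps)
  have "1 * 1 \<le> nbhd_bound n (max_degree n E) R / real (min R n)
      * (max_weight E W / min_weight E W)"
    using 1 2 by (intro mult_mono) linarith+
  then have "1 * ln 2 \<le> nbhd_bound n (max_degree n E) R / real (min R n)
      * (max_weight E W / min_weight E W) * ln (1 / \<epsilon>)"
    using 3 by (intro mult_mono) simp_all
  from mult_left_mono[OF this, of "real n ^ 3"] show ?thesis
    by (simp add: mult.assoc)
qed

theorem corollary1:
  shows "\<exists>(P :: com) (C :: real). C > 0 \<and>
    (\<forall>(n :: nat) (E :: (nat \<times> nat) set) (W :: nat \<Rightarrow> nat \<Rightarrow> real) (b\<^sub>0 :: real vec)
       (R :: nat) (\<epsilon> :: real).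
       weighted_graph n E W \<longrightarrow> E \<noteq> {} \<longrightarrow>
       R \<ge> 1 \<longrightarrow> 0 < \<epsilon> \<longrightarrow> \<epsilon> \<le> 1 / 2 \<longrightarrow>
       (\<exists>x \<in> carrier_vec n. laplacian n E W *\<^sub>v x = b\<^sub>0) \<longrightarrow>
       solves_within P n E R (laplacian n E W) b\<^sub>0 \<epsilon>
         (C * (real n ^ 3 * nbhd_bound n (max_degree n E) R / real (min R n)
               * (max_weight E W / min_weight E W) * ln (1 / \<epsilon>))))"
proof (intro exI conjI allI impI)
  show "309 / ln 2 > (0 :: real)" by simp
next
  fix n E W b and R :: nat and \<epsilon> :: real
  assume graph: "weighted_graph n E W" and "E \<noteq> {}" "R \<ge> 1" "0 < \<epsilon>" "\<epsilon> \<le> 1 / 2"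
    and "\<exists>x \<in> carrier_vec n. laplacian n E W *\<^sub>v x = b"
  then obtain z where z: "z \<in> carrier_vec n" "laplacian n E W *\<^sub>v z = b" by blast
  let ?\<sigma> = "run program n E R (laplacian n E W) b \<epsilon> n"
  let ?B = "real n ^ 3 * nbhd_bound n (max_degree n E) R / real (min R n)
               * (max_weight E W / min_weight E W) * ln (1 / \<epsilon>)"
  note final = after_last_round[OF graph z \<open>R \<ge> 1\<close>, where \<epsilon> = \<epsilon>]
  have "vec n (\<lambda>k. out_val (?\<sigma> k)) = vec n (\<lambda>k. component_solution n E W b k k)"
    using final(2) by (intro eq_vecI) simp_all
  then have "approx_solution (laplacian n E W) b \<epsilon> (vec n (\<lambda>k. out_val (?\<sigma> k)))"
    using component_solution_solves[OF graph z] \<open>0 < \<epsilon>\<close>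
    by (auto intro: exact_solution_approx[OF graph])
  moreover have "real (steps (?\<sigma> k)) \<le> 309 / ln 2 * ?B" if "k < n" for k
  proof -
    have "real (steps (?\<sigma> k)) \<le> real (309 * n ^ 3)"
      using final(3)[OF that] by (simp only: of_nat_le_iff)
    also have "\<dots> = 309 / ln 2 * (real n ^ 3 * ln 2)" by simp
    also have "\<dots> \<le> 309 / ln 2 * ?B"
      using time_bound_ge[OF graph \<open>E \<noteq> {}\<close> \<open>R \<ge> 1\<close> \<open>0 < \<epsilon>\<close> \<open>\<epsilon> \<le> 1 / 2\<close>]
      by (intro mult_left_mono) simp_all
    finally show ?thesis .
  qed
  ultimately show "solves_within program n E R (laplacian n E W) b \<epsilon> (309 / ln 2 * ?B)"
    unfolding solves_within_def Let_def using final(1) by blast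
qed

end
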